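(* Let $q=p^h$, $p$ prime, $n\ge2$ and $0<k\le n-1$. Then $d(C_k(n,q)^\perp)=d(C_1(n-k+1,q)^\perp)$.
   Context: For $1\le k\le m-1$, $C_k(m,q)$ is the $p$-ary linear code spanned over $\mathbb{F}_p$ by the rows of the incidence matrix of $k$-dimensional subspaces versus points of $PG(m,q)$ (entry $1$ iff the point lies in the subspace), $C_k(m,q)^\perp$ its dual code with respect to the standard scalar product, and $d(C)$ denotes the minimum weight (number of nonzero coordinates) of a nonzero codeword of $C$. *)

theory Defs
  imports Complex_Main "HOL-Library.Function_Algebras" "HOL-Library.Cardinality"
    "HOL-Computational_Algebra.Primes"
begin

definition fun_scale :: "'f::field \<Rightarrow> ('i \<Rightarrow> 'f) \<Rightarrow> 'i \<Rightarrow> 'f" where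
  "fun_scale a x = (\<lambda>i. a * x i)"

global_interpretation fun_space: vector_space fun_scale
  by standard (auto simp: fun_scale_def fun_eq_iff algebra_simps)

text \<open>The vector space \<open>F\<^sup>m\<^sup>+\<^sup>1\<close> underlying \<open>PG(m,F)\<close>: coordinates are indexed by \<open>0, \<dots>, m\<close>.\<close>

definition coord_space :: "nat \<Rightarrow> (nat \<Rightarrow> 'a::field) set" where
  "coord_space m = {x. \<forall>i>m. x i = 0}"

text \<open>Projective subspaces are represented by the corresponding vector subspaces, so that
  the projective dimension is one less than the linear dimension.\<close>

definition pg_subspaces :: "nat \<Rightarrow> nat \<Rightarrow> (nat \<Rightarrow> 'a::field) set set" where
  "pg_subspaces m k =
    {U. fun_space.subspace U \<and> U \<subseteq> coord_space m \<and> fun_space.dim U = k + 1}"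

definition pg_points :: "nat \<Rightarrow> (nat \<Rightarrow> 'a::field) set set" where
  "pg_points m = pg_subspaces m 0"

text \<open>Words with coordinate positions \<open>I\<close> are represented by functions on the whole type
  that vanish outside \<open>I\<close>.\<close>

definition incidence_row ::
    "nat \<Rightarrow> (nat \<Rightarrow> 'a::field) set \<Rightarrow> (nat \<Rightarrow> 'a) set \<Rightarrow> 'f::field" where
  "incidence_row m U = (\<lambda>P. if P \<in> pg_points m \<and> P \<subseteq> U then 1 else 0)"

definition pg_code :: "nat \<Rightarrow> nat \<Rightarrow> ((nat \<Rightarrow> 'a::field) set \<Rightarrow> 'f::field) set" where
  "pg_code k m = fun_space.span (incidence_row m ` pg_subspaces m k)"

definition dual_code :: "'i set \<Rightarrow> ('i \<Rightarrow> 'f::field) set \<Rightarrow> ('i \<Rightarrow> 'f) set" where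
  "dual_code I C =
    {c. (\<forall>i. i \<notin> I \<longrightarrow> c i = 0) \<and> (\<forall>u\<in>C. (\<Sum>i\<in>I. c i * u i) = 0)}"

definition weight :: "('i \<Rightarrow> 'f::zero) \<Rightarrow> nat" where
  "weight c = card {i. c i \<noteq> 0}"

text \<open>Junk value: the zero code gets minimum weight \<open>0\<close>.\<close>

definition min_weight :: "('i \<Rightarrow> 'f::zero) set \<Rightarrow> nat" where
  "min_weight C = Inf (weight ` (C - {0}))"

end

theory Submission
  imports Defs "HOL-Library.FuncSet"
begin

text \<open>A word \<open>c\<close> is viewed as the homogeneous function \<open>v \<mapsto> c(\<langle>v\<rangle>)\<close> on nonzero vectors; since
  \<open>q - 1 = -1\<close> in \<open>F\<^sub>p\<close>, orthogonality to a subspace means that this function sums to \<open>0\<close> over its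
  vectors. It suffices to compare \<open>C\<^sub>k(m,q)\<^sup>\<bottom>\<close> with \<open>C\<^sub>k\<^sub>+\<^sub>1(m+1,q)\<^sup>\<bottom>\<close>. A word orthogonal to all
  \<open>k\<close>-spaces of a hyperplane is, modulo \<open>p\<close>, orthogonal to its \<open>(k+1)\<close>-spaces, so that extension by
  zero embeds the first code into the second. In particular a word of minimum weight of the second
  code has at most as many support points as a hyperplane has points, and hence some support point
  lies on a line containing no other support point. Projecting from another point of that line
  gives a nonzero word of the first code of no larger weight.\<close>

section \<open>Counting in subspaces over a finite field\<close>

text \<open>Each fibre of \<open>T\<close> over its image is a translate of the kernel. Serves both
  linear forms and projections from a point.\<close>

lemma card_eq_image_times_kernel:
  fixes T :: "'a::ab_group_add \<Rightarrow> 'b::ab_group_add"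
  assumes fin: "finite W"
    and add: "\<And>x y. x \<in> W \<Longrightarrow> y \<in> W \<Longrightarrow> x + y \<in> W"
    and diff: "\<And>x y. x \<in> W \<Longrightarrow> y \<in> W \<Longrightarrow> x - y \<in> W"
    and T: "\<And>x y. T (x + y) = T x + T y"
  shows "card W = card (T ` W) * card {v \<in> W. T v = 0}"
proof -
  have Td: "T (x - y) = T x - T y" for x y
    using T[of "x - y" y] by (simp add: algebra_simps)
  have fib: "card {v \<in> W. T v = z} = card {v \<in> W. T v = 0}" if z: "z \<in> T ` W" for z
  proof -
    obtain w where w: "w \<in> W" "T w = z" using z by auto
    have "bij_betw (\<lambda>v. v - w) {v \<in> W. T v = z} {v \<in> W. T v = 0}"
      by (rule bij_betw_byWitness[where f' = "\<lambda>v. v + w"])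
        (use w add diff in \<open>auto simp: T Td\<close>)
    then show ?thesis by (rule bij_betw_same_card)
  qed
  have "card W = (\<Sum>z\<in>T ` W. card {v \<in> W. T v = z})"
    using sum.image_gen[OF fin, of "\<lambda>_. 1::nat" T] by simp
  also have "\<dots> = card (T ` W) * card {v \<in> W. T v = 0}"
    using fib by simp
  finally show ?thesis .
qed

lemma card_field_ge_2: "CARD('q::{field,finite}) \<ge> 2"
proof -
  have "card {0, 1 :: 'q} \<le> CARD('q)" by (rule card_mono) auto
  then show ?thesis by simp
qed

text \<open>Adjoining \<open>b\<close> multiplies the count by \<open>q\<close>: each vector of the
  new span is \<open>x + a b\<close> for exactly one scalar \<open>a\<close> and one
  \<open>x\<close> in the old span.\<close>

lemma card_span_independent:
  fixes B :: "('i \<Rightarrow> 'q::{field,finite}) set"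
  assumes "finite B" "fun_space.independent B"
  shows "finite (fun_space.span B) \<and> card (fun_space.span B) = CARD('q) ^ card B"
  using assms
proof (induction B rule: finite_induct)
  case empty
  then show ?case by simp
next
  case (insert b B)
  have ind: "fun_space.independent B" and b: "b \<notin> fun_space.span B"
    using insert by (auto simp: fun_space.independent_insert)
  have IH: "finite (fun_space.span B)" "card (fun_space.span B) = CARD('q) ^ card B"
    using insert.IH[OF ind] by auto
  let ?g = "\<lambda>(a :: 'q, x). x + fun_scale a b"
  have "inj_on ?g (UNIV \<times> fun_space.span B)"
  proof (rule inj_onI, clarify)
    fix a a' :: 'q and x x'
    assume x: "x \<in> fun_space.span B" "x' \<in> fun_space.span B"
      and eq: "x + fun_scale a b = x' + fun_scale a' b"
    have "fun_scale (a - a') b = x' - x"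
      using eq by (simp add: fun_space.scale_left_diff_distrib algebra_simps)
    then have "fun_scale (a - a') b \<in> fun_space.span B"
      using x by (simp add: fun_space.span_diff)
    \<comment> \<open>Otherwise dividing by \<open>a - a'\<close> would put \<open>b\<close> into
      the span of \<open>B\<close>.\<close>
    then have "a = a'"
      using b fun_space.span_scale[of "fun_scale (a - a') b" B "inverse (a - a')"]
      by (cases "a = a'") auto
    then show "a = a' \<and> x = x'" using eq by simp
  qed
  moreover have "?g ` (UNIV \<times> fun_space.span B) = fun_space.span (insert b B)"
  proof (rule set_eqI)
    fix x
    have "x \<in> ?g ` (UNIV \<times> fun_space.span B) \<longleftrightarrow>
        (\<exists>a. x - fun_scale a b \<in> fun_space.span B)"
    proof
      assume "\<exists>a. x - fun_scale a b \<in> fun_space.span B"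
      then obtain a where "x - fun_scale a b \<in> fun_space.span B" by blast
      then show "x \<in> ?g ` (UNIV \<times> fun_space.span B)"
        by (intro image_eqI[of _ _ "(a, x - fun_scale a b)"]) auto
    next
      assume "x \<in> ?g ` (UNIV \<times> fun_space.span B)"
      then obtain a y where "y \<in> fun_space.span B" "x = y + fun_scale a b" by auto
      then show "\<exists>a. x - fun_scale a b \<in> fun_space.span B" by (intro exI[of _ a]) simp
    qed
    then show "x \<in> ?g ` (UNIV \<times> fun_space.span B) \<longleftrightarrow> x \<in> fun_space.span (insert b B)"
      by (simp add: fun_space.span_breakdown_eq)
  qed
  ultimately have bij: "bij_betw ?g (UNIV \<times> fun_space.span B) (fun_space.span (insert b B))"
    by (simp add: bij_betw_def)
  have "finite (fun_space.span (insert b B))"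
    using bij_betw_finite[OF bij] IH(1) by simp
  moreover have "card (fun_space.span (insert b B)) = CARD('q) * card (fun_space.span B)"
    using bij_betw_same_card[OF bij] by (simp add: card_cartesian_product)
  ultimately show ?case using IH insert by simp
qed

lemma card_subspace:
  fixes U :: "('i \<Rightarrow> 'q::{field,finite}) set"
  assumes "fun_space.subspace U" "finite U"
  shows "card U = CARD('q) ^ fun_space.dim U"
proof -
  obtain B where B: "B \<subseteq> U" "fun_space.independent B" "U \<subseteq> fun_space.span B"
    "card B = fun_space.dim U"
    using fun_space.basis_exists by blast
  have "fun_space.span B = U"
    using B assms(1) fun_space.span_subspace by blast
  moreover have "finite B" using B(1) assms(2) finite_subset by blast
  ultimately show ?thesis using card_span_independent B by metis
qed

lemma card_span_singleton:
  fixes v :: "'i \<Rightarrow> 'q::{field,finite}"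
  assumes "v \<noteq> 0"
  shows "finite (fun_space.span {v})" "card (fun_space.span {v}) = CARD('q)"
  using card_span_independent[of "{v}"] assms by auto

lemma span_singleton_subset:
  "fun_space.subspace U \<Longrightarrow> v \<in> U \<Longrightarrow> fun_space.span {v} \<subseteq> U"
  by (simp add: fun_space.span_minimal)

lemma subspace_coord_space: "fun_space.subspace (coord_space m)"
  by (auto simp: fun_space.subspace_def coord_space_def fun_scale_def)

lemma card_coord_space:
  "finite (coord_space m :: (nat \<Rightarrow> 'q::{field,finite}) set) \<and>
   card (coord_space m :: (nat \<Rightarrow> 'q) set) = CARD('q) ^ (m + 1)"
proof -
  have "bij_betw (\<lambda>f. restrict f {..m}) (coord_space m :: (nat \<Rightarrow> 'q) set)
      (PiE {..m} (\<lambda>_. UNIV))"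
    by (rule bij_betw_byWitness[where f' = "\<lambda>f i. if i \<le> m then f i else 0"])
      (auto simp: coord_space_def fun_eq_iff PiE_def extensional_def)
  moreover have "finite (PiE {..m} (\<lambda>_. UNIV :: 'q set))"
    by (rule finite_PiE) auto
  ultimately show ?thesis
    using bij_betw_finite bij_betw_same_card by (fastforce simp: card_PiE)
qed

lemmas finite_coord_space = card_coord_space[THEN conjunct1]

lemma coord_space_mono: "m \<le> n \<Longrightarrow> coord_space m \<subseteq> coord_space n"
  by (auto simp: coord_space_def)

text \<open>As \<open>q > 1\<close>, the cardinality \<open>q ^ d\<close> determines
  \<open>d\<close>. From here on dimensions are read off by counting vectors.\<close>

lemma pg_subspaces_eq_card:
  "(pg_subspaces m k :: (nat \<Rightarrow> 'q::{field,finite}) set set) =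
    {U. fun_space.subspace U \<and> U \<subseteq> coord_space m \<and> card U = CARD('q) ^ (k + 1)}"
proof -
  have "fun_space.dim U = k + 1 \<longleftrightarrow> card U = CARD('q) ^ (k + 1)"
    if "fun_space.subspace U" "U \<subseteq> coord_space m" for U :: "(nat \<Rightarrow> 'q) set"
  proof -
    have "card U = CARD('q) ^ fun_space.dim U"
      using that card_subspace finite_coord_space finite_subset by blast
    moreover have "1 < CARD('q)" using card_field_ge_2[where 'q = 'q] by simp
    ultimately show ?thesis by (metis power_inject_exp)
  qed
  then show ?thesis unfolding pg_subspaces_def by blast
qed

text \<open>A linear form that is not zero on \<open>W\<close> takes every value in the field, since
  \<open>w\<close> can be rescaled; hence its kernel in \<open>W\<close> has index
  \<open>q\<close>.\<close>

lemma card_hyperplane: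
  fixes W :: "('i \<Rightarrow> 'q::{field,finite}) set" and \<phi> :: "('i \<Rightarrow> 'q) \<Rightarrow> 'q"
  assumes W: "fun_space.subspace W" "finite W" "card W = CARD('q) ^ Suc d"
    and \<phi>: "\<And>x y. \<phi> (x + y) = \<phi> x + \<phi> y" "\<And>a x. \<phi> (fun_scale a x) = a * \<phi> x"
    and w: "w \<in> W" "\<phi> w \<noteq> 0"
  shows "fun_space.subspace {v \<in> W. \<phi> v = 0}" "card {v \<in> W. \<phi> v = 0} = CARD('q) ^ d"
proof -
  have z: "\<phi> 0 = 0" using \<phi>(2)[of 0 0] by simp
  show "fun_space.subspace {v \<in> W. \<phi> v = 0}"
    using W(1) z \<phi> by (auto simp: fun_space.subspace_def)
  have "a \<in> \<phi> ` W" for a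
    using W(1) w \<phi>(2)[of "a / \<phi> w" w]
    by (auto simp: image_iff fun_space.subspace_scale intro!: bexI[of _ "fun_scale (a / \<phi> w) w"])
  then have "\<phi> ` W = UNIV" by blast
  moreover have "card W = card (\<phi> ` W) * card {v \<in> W. \<phi> v = 0}"
    by (rule card_eq_image_times_kernel)
      (use W \<phi> in \<open>auto simp: fun_space.subspace_add fun_space.subspace_diff\<close>)
  ultimately show "card {v \<in> W. \<phi> v = 0} = CARD('q) ^ d"
    using W(3) by simp
qed

text \<open>Take coordinates \<open>i\<close>, \<open>j\<close> independent on \<open>W\<close>. Every vector is a zero of a multiple of \<open>q\<close> many
  of the forms \<open>a x\<^sub>i + b x\<^sub>j\<close>, and each of these except the zero form cuts out a hyperplane of
  \<open>W\<close>.\<close>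

lemma sum_subspace_eq_0_of_hyperplanes:
  fixes W :: "('i \<Rightarrow> 'q::{field,finite}) set" and f :: "('i \<Rightarrow> 'q) \<Rightarrow> 'f::field"
  assumes char: "of_nat CARD('q) = (0::'f)"
    and W: "fun_space.subspace W" "finite W" "card W = CARD('q) ^ Suc d" and d: "d \<ge> 1"
    and hyp: "\<And>H. fun_space.subspace H \<Longrightarrow> H \<subseteq> W \<Longrightarrow> card H = CARD('q) ^ d \<Longrightarrow> sum f H = 0"
  shows "sum f W = 0"
proof -
  have nz: "\<exists>w\<in>V. \<exists>i. w i \<noteq> 0" if V: "finite V" "card V = CARD('q) ^ Suc e"
    for V :: "('i \<Rightarrow> 'q) set" and e
  proof (rule ccontr)
    assume "\<not> ?thesis"
    then have "V \<subseteq> {0}" by (auto simp: fun_eq_iff)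
    then have "card V \<le> 1" using card_mono[of "{0}" V] by simp
    moreover have "CARD('q) ^ Suc e > 1"
      using card_field_ge_2[where 'q = 'q] by (intro one_less_power) auto
    ultimately show False using V by simp
  qed
  obtain u i where u: "u \<in> W" "u i \<noteq> 0" using nz W by blast
  \<comment> \<open>Since \<open>d \<ge> 1\<close>, this kernel contains a nonzero vector
    \<open>w\<close>. A coordinate \<open>j\<close> with \<open>w j \<noteq> 0\<close> is then
    independent of coordinate \<open>i\<close> on \<open>W\<close>.\<close>
  let ?V = "{v \<in> W. v i = 0}"
  have "card ?V = CARD('q) ^ d"
    by (rule card_hyperplane(2)[OF W, where \<phi> = "\<lambda>v. v i" and w = u])
      (use u in \<open>auto simp: fun_scale_def\<close>)
  moreover obtain e where "d = Suc e" using d by (cases d) auto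
  ultimately obtain w j where w: "w \<in> W" "w i = 0" "w j \<noteq> 0"
    using nz[of ?V e] W by auto
  let ?\<phi> = "\<lambda>(a, b) v. a * v i + b * v j :: 'q"
  have H0: "sum f {v \<in> W. ?\<phi> ab v = 0} = 0" if ab: "ab \<noteq> (0, 0)" for ab
  proof -
    obtain a b where [simp]: "ab = (a, b)" by (cases ab)
    \<comment> \<open>For \<open>b = 0\<close> the vector \<open>u\<close> is a witness; otherwise
      \<open>w\<close> is, because \<open>w i = 0\<close>.\<close>
    have "\<exists>x\<in>W. ?\<phi> ab x \<noteq> 0"
      using ab bexI[OF _ u(1), of "\<lambda>x. ?\<phi> ab x \<noteq> 0"] bexI[OF _ w(1), of "\<lambda>x. ?\<phi> ab x \<noteq> 0"] u w
      by (cases "b = 0") simp_all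
    then obtain x where x: "x \<in> W" "?\<phi> ab x \<noteq> 0" by blast
    show ?thesis
    proof (rule hyp)
      show "fun_space.subspace {v \<in> W. ?\<phi> ab v = 0}" "card {v \<in> W. ?\<phi> ab v = 0} = CARD('q) ^ d"
        by (rule card_hyperplane[OF W, where \<phi> = "?\<phi> ab" and w = x];
            use x in \<open>simp add: fun_scale_def algebra_simps\<close>)+
    qed auto
  qed
  \<comment> \<open>The count is \<open>q^2\<close> if both coordinates of \<open>v\<close> vanish
    and \<open>q\<close> otherwise; when \<open>v j \<noteq> 0\<close>, the coefficient
    \<open>b\<close> is determined by \<open>a\<close>.\<close>
  have cnt: "of_nat (card {ab. ?\<phi> ab v = 0}) = (0::'f)" for v
  proof (cases "v j = 0")
    case True
    have "{ab. ?\<phi> ab v = 0} = (if v i = 0 then UNIV else {0} \<times> UNIV)"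
      using True by auto
    then show ?thesis using char by (auto simp: card_cartesian_product)
  next
    case False
    have "{ab. ?\<phi> ab v = 0} = (\<lambda>a. (a, - a * v i / v j)) ` UNIV"
      using False by (auto simp: image_iff field_simps add_eq_0_iff2)
    then have "card {ab. ?\<phi> ab v = 0} = CARD('q)"
      by (simp add: card_image inj_on_def)
    then show ?thesis using char by simp
  qed
  \<comment> \<open>Only the zero form survives, and its zero set is all of \<open>W\<close>.
    Exchanging the two sums then brings in the counts just computed.\<close>
  have "(\<Sum>ab\<in>UNIV. sum f {v \<in> W. ?\<phi> ab v = 0}) = sum f {v \<in> W. ?\<phi> (0, 0) v = 0}"
    using H0 by (subst sum.remove[of _ "(0, 0)"]) auto
  then have "sum f W = (\<Sum>ab\<in>UNIV. \<Sum>v\<in>{v \<in> W. ?\<phi> ab v = 0}. f v)"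
    by simp
  also have "\<dots> = (\<Sum>v\<in>W. \<Sum>ab\<in>{ab \<in> UNIV. ?\<phi> ab v = 0}. f v)"
    using W(2) by (intro sum.swap_restrict) auto
  also have "\<dots> = (\<Sum>v\<in>W. of_nat (card {ab. ?\<phi> ab v = 0}) * f v)"
    by simp
  also have "\<dots> = 0" by (simp only: cnt) simp
  finally show ?thesis .
qed

section \<open>Words as homogeneous functions on vectors\<close>

text \<open>The value \<open>0\<close> at the zero vector, which spans no point, keeps it from
  contributing to sums over subspaces.\<close>

definition lift_word :: "(('i \<Rightarrow> 'q::field) set \<Rightarrow> 'f::zero) \<Rightarrow> ('i \<Rightarrow> 'q) \<Rightarrow> 'f" where
  "lift_word c v = (if v = 0 then 0 else c (fun_space.span {v}))"

text \<open>The image of the dual code under \<open>lift_word\<close> when \<open>q\<close> is zero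
  in \<open>'f\<close>. The exponent \<open>k + 1\<close> is the linear dimension of a projective
  \<open>k\<close>-space.\<close>

definition vector_words :: "nat \<Rightarrow> nat \<Rightarrow> ((nat \<Rightarrow> 'q::{field,finite}) \<Rightarrow> 'f::field) set" where
  "vector_words k m = {f. f 0 = 0 \<and> (\<forall>v. v \<notin> coord_space m \<longrightarrow> f v = 0) \<and>
     (\<forall>a v. a \<noteq> 0 \<longrightarrow> f (fun_scale a v) = f v) \<and>
     (\<forall>U. fun_space.subspace U \<longrightarrow> U \<subseteq> coord_space m \<longrightarrow>
        card U = CARD('q) ^ (k + 1) \<longrightarrow> sum f U = 0)}"

lemma span_scale_singleton:
  fixes v :: "'i \<Rightarrow> 'q::field"
  assumes "a \<noteq> 0"
  shows "fun_space.span {fun_scale a v} = fun_space.span {v}"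
proof (rule antisym)
  show "fun_space.span {fun_scale a v} \<subseteq> fun_space.span {v}"
    by (rule fun_space.span_minimal) (auto intro: fun_space.span_scale fun_space.span_base)
  have "fun_scale (inverse a) (fun_scale a v) \<in> fun_space.span {fun_scale a v}"
    by (intro fun_space.span_scale fun_space.span_base) simp
  then show "fun_space.span {v} \<subseteq> fun_space.span {fun_scale a v}"
    using assms by (intro fun_space.span_minimal) auto
qed

lemma mem_span_singleton:
  fixes v :: "'i \<Rightarrow> 'q::field"
  shows "x \<in> fun_space.span {v} \<longleftrightarrow> (\<exists>a. x = fun_scale a v)"
  by (auto simp: fun_space.span_singleton)

lemma span_singleton_eq:
  fixes v :: "'i \<Rightarrow> 'q::field"
  assumes "x \<in> fun_space.span {v}" "x \<noteq> 0"
  shows "fun_space.span {x} = fun_space.span {v}"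
proof -
  obtain a where "x = fun_scale a v" using assms mem_span_singleton by blast
  then show ?thesis using assms span_scale_singleton[of a v] by (cases "a = 0") auto
qed

lemma pg_points_eq:
  "(pg_points m :: (nat \<Rightarrow> 'q::{field,finite}) set set) =
    (\<lambda>v. fun_space.span {v}) ` (coord_space m - {0})"
proof (intro equalityI subsetI)
  fix P :: "(nat \<Rightarrow> 'q) set" assume "P \<in> pg_points m"
  then have P: "fun_space.subspace P" "P \<subseteq> coord_space m" "card P = CARD('q)"
    by (auto simp: pg_points_def pg_subspaces_eq_card)
  have "\<not> P \<subseteq> {0}"
    using P(3) card_field_ge_2[where 'q = 'q] card_mono[of "{0}" P] by auto
  then obtain v where v: "v \<in> P" "v \<noteq> 0" by auto
  have "fun_space.span {v} \<subseteq> P" using v P by (intro span_singleton_subset)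
  moreover have "finite P" using P finite_coord_space finite_subset by blast
  ultimately have "fun_space.span {v} = P"
    using card_span_singleton[OF v(2)] P(3) by (intro card_subset_eq) auto
  then show "P \<in> (\<lambda>v. fun_space.span {v}) ` (coord_space m - {0})"
    using v P by auto
next
  fix P :: "(nat \<Rightarrow> 'q) set" assume "P \<in> (\<lambda>v. fun_space.span {v}) ` (coord_space m - {0})"
  then obtain v where v: "v \<in> coord_space m" "v \<noteq> 0" "P = fun_space.span {v}" by auto
  then show "P \<in> pg_points m"
    using card_span_singleton(2)[OF v(2)] span_singleton_subset[OF subspace_coord_space v(1)]
    by (auto simp: pg_points_def pg_subspaces_eq_card)
qed

lemma finite_pg_points: "finite (pg_points m :: (nat \<Rightarrow> 'q::{field,finite}) set set)"
  by (simp add: pg_points_eq finite_coord_space)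

lemma span_mem_pg_points_iff:
  fixes v :: "nat \<Rightarrow> 'q::{field,finite}"
  assumes "v \<noteq> 0"
  shows "fun_space.span {v} \<in> pg_points m \<longleftrightarrow> v \<in> coord_space m"
proof
  assume "fun_space.span {v} \<in> pg_points m"
  then have "fun_space.span {v} \<subseteq> coord_space m"
    by (auto simp: pg_points_def pg_subspaces_def)
  then show "v \<in> coord_space m" using fun_space.span_base[of v "{v}"] by auto
qed (use assms in \<open>auto simp: pg_points_eq\<close>)

lemma nonzero_vectors_of_point:
  fixes P :: "(nat \<Rightarrow> 'q::{field,finite}) set"
  assumes "P \<in> pg_points m" "P \<subseteq> U"
  shows "{v \<in> U - {0}. fun_space.span {v} = P} = P - {0}"
proof -
  obtain u where u: "P = fun_space.span {u}" using assms by (auto simp: pg_points_eq)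
  show ?thesis
    using assms(2) span_singleton_eq[of _ u] fun_space.span_base unfolding u by blast
qed

lemma card_point_minus_zero:
  fixes P :: "(nat \<Rightarrow> 'q::{field,finite}) set"
  assumes "P \<in> pg_points m"
  shows "card (P - {0}) = CARD('q) - 1"
proof -
  have "0 \<in> P" "card P = CARD('q)"
    using assms by (auto simp: pg_points_def pg_subspaces_eq_card fun_space.subspace_0)
  then show ?thesis by simp
qed

text \<open>The nonzero vectors of \<open>U\<close> are partitioned by the points they span, with
  \<open>q - 1\<close> vectors for each point.\<close>

lemma sum_lift_word:
  fixes U :: "(nat \<Rightarrow> 'q::{field,finite}) set" and c :: "(nat \<Rightarrow> 'q) set \<Rightarrow> 'f::field"
  assumes U: "fun_space.subspace U" "U \<subseteq> coord_space m"
  shows "sum (lift_word c) U = of_nat (CARD('q) - 1) * (\<Sum>P | P \<in> pg_points m \<and> P \<subseteq> U. c P)"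
proof -
  have finU: "finite U" using U finite_coord_space finite_subset by blast
  let ?S = "\<lambda>v. fun_space.span {v}"
  have im: "?S ` (U - {0}) = {P \<in> pg_points m. P \<subseteq> U}"
  proof (intro equalityI subsetI)
    fix P assume "P \<in> ?S ` (U - {0})"
    then obtain v where v: "v \<in> U" "v \<noteq> 0" "P = ?S v" by auto
    then show "P \<in> {P \<in> pg_points m. P \<subseteq> U}"
      using U span_singleton_subset[OF U(1) v(1)] by (auto simp: span_mem_pg_points_iff)
  next
    fix P assume P: "P \<in> {P \<in> pg_points m. P \<subseteq> U}"
    then obtain v where "P = ?S v" "v \<noteq> 0" by (auto simp: pg_points_eq)
    then show "P \<in> ?S ` (U - {0})" using P fun_space.span_base[of v "{v}"] by auto
  qed
  have "sum (lift_word c) U = sum (lift_word c) (U - {0})"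
    using finU by (intro sum.mono_neutral_right) (auto simp: lift_word_def)
  also have "\<dots> = (\<Sum>P\<in>?S ` (U - {0}). \<Sum>v\<in>{v \<in> U - {0}. ?S v = P}. lift_word c v)"
    using finU by (intro sum.image_gen) auto
  also have "\<dots> = (\<Sum>P | P \<in> pg_points m \<and> P \<subseteq> U. of_nat (CARD('q) - 1) * c P)"
  proof (subst im, rule sum.cong[OF refl])
    fix P assume P: "P \<in> {P \<in> pg_points m. P \<subseteq> U}"
    have "(\<Sum>v\<in>{v \<in> U - {0}. ?S v = P}. lift_word c v) = (\<Sum>v\<in>{v \<in> U - {0}. ?S v = P}. c P)"
      by (rule sum.cong) (auto simp: lift_word_def)
    also have "\<dots> = of_nat (CARD('q) - 1) * c P"
      using P nonzero_vectors_of_point[of P m U] card_point_minus_zero[of P m] by simp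
    finally show "(\<Sum>v\<in>{v \<in> U - {0}. ?S v = P}. lift_word c v) = of_nat (CARD('q) - 1) * c P" .
  qed
  finally show ?thesis by (simp add: sum_distrib_left)
qed

text \<open>The words orthogonal to a fixed \<open>c\<close> form a subspace, so orthogonality can
  be tested on generators.\<close>

lemma dual_code_span:
  "dual_code I (fun_space.span S) =
    {c. (\<forall>i. i \<notin> I \<longrightarrow> c i = 0) \<and> (\<forall>u\<in>S. (\<Sum>i\<in>I. c i * u i) = 0)}"
proof -
  have "(\<Sum>i\<in>I. c i * u i) = 0"
    if c: "\<forall>u\<in>S. (\<Sum>i\<in>I. c i * u i) = 0" and u: "u \<in> fun_space.span S" for c u
  proof -
    have "fun_space.subspace {u. (\<Sum>i\<in>I. c i * u i) = 0}"
      by (auto simp: fun_space.subspace_def fun_scale_def algebra_simps sum.distrib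
          simp flip: sum_distrib_left)
    then have "fun_space.span S \<subseteq> {u. (\<Sum>i\<in>I. c i * u i) = 0}"
      using c by (intro fun_space.span_minimal) auto
    then show ?thesis using u by auto
  qed
  then show ?thesis unfolding dual_code_def using fun_space.span_base by blast
qed

text \<open>The factor \<open>q - 1\<close> between vector sums and point sums equals
  \<open>-1\<close> in \<open>'f\<close>, so one sum vanishes exactly when the other does.\<close>

lemma dual_pg_code_iff:
  fixes c :: "(nat \<Rightarrow> 'q::{field,finite}) set \<Rightarrow> 'f::field"
  assumes char: "of_nat CARD('q) = (0::'f)"
  shows "c \<in> dual_code (pg_points m) (pg_code k m) \<longleftrightarrow>
    (\<forall>P. P \<notin> pg_points m \<longrightarrow> c P = 0) \<and> lift_word c \<in> vector_words k m"
proof -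
  have q1: "of_nat (CARD('q) - 1) \<noteq> (0::'f)"
    using char card_field_ge_2[where 'q = 'q] by (simp add: of_nat_diff)
  have row: "(\<Sum>P\<in>pg_points m. c P * incidence_row m U P) =
      (\<Sum>P | P \<in> pg_points m \<and> P \<subseteq> U. c P)" for U
    unfolding incidence_row_def
    by (rule sum.mono_neutral_cong_right) (auto simp: finite_pg_points)
  have "lift_word c \<in> vector_words k m \<longleftrightarrow>
      (\<forall>U\<in>pg_subspaces m k. sum (lift_word c) U = 0)" if "\<forall>P. P \<notin> pg_points m \<longrightarrow> c P = 0"
  proof -
    have "lift_word c v = 0" if "v \<notin> coord_space m" for v
      using that \<open>\<forall>P. _\<close> span_mem_pg_points_iff[of v m] by (auto simp: lift_word_def)
    moreover have "lift_word c (fun_scale a v) = lift_word c v" if "a \<noteq> 0" for a v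
      using that by (auto simp: lift_word_def span_scale_singleton)
    ultimately show ?thesis
      by (auto simp: vector_words_def pg_subspaces_eq_card lift_word_def[of _ 0])
  qed
  moreover have "(\<forall>U\<in>pg_subspaces m k. sum (lift_word c) U = 0) \<longleftrightarrow>
      (\<forall>U\<in>pg_subspaces m k. (\<Sum>P | P \<in> pg_points m \<and> P \<subseteq> U. c P) = 0)"
    using q1 by (intro ball_cong refl) (auto simp: sum_lift_word[of _ m] pg_subspaces_def)
  ultimately show ?thesis
    unfolding pg_code_def dual_code_span by (auto simp: row)
qed

text \<open>Distinct points share only the zero vector, so the support of the lift is the disjoint
  union of the sets \<open>P - {0}\<close> over the support points. Comparing weights thus amounts
  to comparing supports of lifts.\<close>

lemma card_support_lift_word:
  fixes c :: "(nat \<Rightarrow> 'q::{field,finite}) set \<Rightarrow> 'f::field"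
  assumes "\<forall>P. P \<notin> pg_points m \<longrightarrow> c P = 0"
  shows "card {v. lift_word c v \<noteq> 0} = (CARD('q) - 1) * weight c"
proof -
  let ?S = "\<lambda>v. fun_space.span {v}"
  have sub: "{P. c P \<noteq> 0} \<subseteq> pg_points m" using assms by auto
  have "{v. lift_word c v \<noteq> 0} = (\<Union>P\<in>{P. c P \<noteq> 0}. P - {0})"
  proof (intro equalityI subsetI)
    fix v assume "v \<in> {v. lift_word c v \<noteq> 0}"
    then show "v \<in> (\<Union>P\<in>{P. c P \<noteq> 0}. P - {0})"
      using fun_space.span_base[of v "{v}"] by (auto simp: lift_word_def split: if_splits)
  next
    fix v assume "v \<in> (\<Union>P\<in>{P. c P \<noteq> 0}. P - {0})"
    then obtain P where P: "c P \<noteq> 0" "v \<in> P" "v \<noteq> 0" by auto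
    then have "P \<in> pg_points m" using sub by blast
    then obtain u where "P = ?S u" unfolding pg_points_eq by blast
    then have "?S v = P" using span_singleton_eq P by blast
    then show "v \<in> {v. lift_word c v \<noteq> 0}" using P by (auto simp: lift_word_def)
  qed
  also have "card \<dots> = (\<Sum>P\<in>{P. c P \<noteq> 0}. card (P - {0}))"
  proof (rule card_UN_disjoint)
    show "finite {P. c P \<noteq> 0}" using sub finite_pg_points finite_subset by blast
    show "\<forall>P\<in>{P. c P \<noteq> 0}. finite (P - {0})"
    proof
      fix P assume "P \<in> {P. c P \<noteq> 0}"
      then have "P \<in> pg_points m" using sub by blast
      then obtain v where "P = ?S v" "v \<noteq> 0" by (auto simp: pg_points_eq)
      then show "finite (P - {0})" using card_span_singleton(1)[of v] by simp
    qed
    show "\<forall>P\<in>{P. c P \<noteq> 0}. \<forall>P'\<in>{P. c P \<noteq> 0}. P \<noteq> P' \<longrightarrow> (P - {0}) \<inter> (P' - {0}) = {}"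
    proof (intro ballI impI equals0I)
      fix P P' v assume "P \<in> {P. c P \<noteq> 0}" "P' \<in> {P. c P \<noteq> 0}" "P \<noteq> P'"
        and v: "v \<in> (P - {0}) \<inter> (P' - {0})"
      then have "P \<in> pg_points m" "P' \<in> pg_points m" using sub by blast+
      then obtain u u' where "P = ?S u" "P' = ?S u'" unfolding pg_points_eq by blast
      then have "?S v = P" "?S v = P'" using span_singleton_eq v by blast+
      then show False using \<open>P \<noteq> P'\<close> by simp
    qed
  qed
  also have "\<dots> = (CARD('q) - 1) * weight c"
  proof -
    have "(\<Sum>P\<in>{P. c P \<noteq> 0}. card (P - {0})) = (\<Sum>P\<in>{P. c P \<noteq> 0}. CARD('q) - 1)"
      using sub by (intro sum.cong refl card_point_minus_zero[of _ m]) auto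
    then show ?thesis by (simp add: weight_def)
  qed
  finally show ?thesis .
qed

text \<open>By homogeneity \<open>f\<close> is constant on the nonzero vectors of a point, so the
  value there may be read at an arbitrarily chosen one.\<close>

lemma lift_word_surj:
  fixes f :: "(nat \<Rightarrow> 'q::{field,finite}) \<Rightarrow> 'f::field"
  assumes char: "of_nat CARD('q) = (0::'f)" and f: "f \<in> vector_words k m"
  obtains c where "c \<in> dual_code (pg_points m) (pg_code k m)" "lift_word c = f"
proof -
  define c where "c P = (if P \<in> pg_points m then f (SOME v. v \<in> P - {0}) else 0)" for P
  have "lift_word c v = f v" for v
  proof (cases "v = 0 \<or> v \<notin> coord_space m")
    case True
    then have "f v = 0" using f unfolding vector_words_def by blast
    then show ?thesis
      using True span_mem_pg_points_iff[of v m] by (auto simp: lift_word_def c_def)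
  next
    case False
    let ?u = "SOME u. u \<in> fun_space.span {v} - {0}"
    have "?u \<in> fun_space.span {v} - {0}"
      using False fun_space.span_base[of v "{v}"] someI[of "\<lambda>u. u \<in> fun_space.span {v} - {0}" v]
      by simp
    then obtain a where "?u = fun_scale a v" "a \<noteq> 0"
      using mem_span_singleton[of ?u v] by auto
    then have "f ?u = f v" using f by (simp add: vector_words_def)
    then show ?thesis using False by (simp add: lift_word_def c_def span_mem_pg_points_iff)
  qed
  then have "lift_word c = f" by auto
  then show thesis
    using that[of c] f by (simp add: dual_pg_code_iff[OF char]) (simp add: c_def)
qed

section \<open>Projection from a point\<close>

text \<open>With a pivot \<open>j\<close> where \<open>r j \<noteq> 0\<close>, subtracting a
  multiple of \<open>r\<close> clears coordinate \<open>j\<close>; the last coordinate is then moved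
  into the vacated place. This realises the quotient by the span of \<open>r\<close> inside
  \<open>coord_space m\<close>.\<close>

lemma projection_exists:
  fixes r :: "nat \<Rightarrow> 'q::field"
  assumes r: "r \<in> coord_space (Suc m)" "r \<noteq> 0"
  obtains T :: "(nat \<Rightarrow> 'q) \<Rightarrow> nat \<Rightarrow> 'q" where
    "\<And>x y. T (x + y) = T x + T y" "\<And>a x. T (fun_scale a x) = fun_scale a (T x)"
    "T ` coord_space (Suc m) = coord_space m"
    "\<And>x. x \<in> coord_space (Suc m) \<Longrightarrow> T x = 0 \<longleftrightarrow> x \<in> fun_space.span {r}"
proof -
  let ?n = "Suc m"
  obtain j where j: "r j \<noteq> 0" "j \<le> ?n"
    using r by (auto simp: fun_eq_iff coord_space_def) (metis not_le)
  define y where "y x i = x i - x j / r j * r i" for x i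
  \<comment> \<open>The test \<open>i = ?n\<close> comes first, so for \<open>j = ?n\<close> the
    cleared last coordinate is simply dropped.\<close>
  define T where "T x i = (if i = ?n then 0 else if i = j then y x ?n else y x i)" for x i
  have im: "T ` coord_space ?n = coord_space m"
  proof (intro equalityI subsetI)
    fix z assume "z \<in> T ` coord_space ?n"
    then show "z \<in> coord_space m"
      using r j by (auto simp: coord_space_def T_def y_def)
  next
    fix z :: "nat \<Rightarrow> 'q" assume z: "z \<in> coord_space m"
    \<comment> \<open>A preimage with \<open>x j = 0\<close>, so that no multiple of
      \<open>r\<close> is subtracted.\<close>
    define x where "x i = (if i = j then 0 else if i = ?n then z j else z i)" for i
    have "x \<in> coord_space ?n" using z j by (auto simp: coord_space_def x_def)
    moreover have "T x = z"
      using z j by (auto simp: coord_space_def T_def y_def x_def)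
    ultimately show "z \<in> T ` coord_space ?n" by blast
  qed
  have ker: "T x = 0 \<longleftrightarrow> x \<in> fun_space.span {r}" if x: "x \<in> coord_space ?n" for x
  proof
    assume T0: "T x = 0"
    have "y x i = 0" for i
    proof -
      have "y x j = 0" using j by (simp add: y_def)
      moreover have "T x i = 0" "T x j = 0" using T0 by simp_all
      ultimately show ?thesis
        unfolding T_def by (cases "i = ?n"; cases "i = j"; cases "j = ?n") auto
    qed
    then have "x i = fun_scale (x j / r j) r i" for i
      using eq_iff_diff_eq_0[of "x i"] unfolding y_def fun_scale_def by blast
    then have "x = fun_scale (x j / r j) r" by blast
    then show "x \<in> fun_space.span {r}" using mem_span_singleton by blast
  next
    assume "x \<in> fun_space.span {r}"
    then obtain a where "x = fun_scale a r" using mem_span_singleton by blast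
    then show "T x = 0" using j by (auto simp: T_def y_def fun_scale_def)
  qed
  show thesis
  proof (rule that[of T, OF _ _ im ker])
    show "T (x + x') = T x + T x'" for x x'
      by (auto simp: T_def y_def fun_eq_iff add_divide_distrib algebra_simps)
    show "T (fun_scale a x) = fun_scale a (T x)" for a x
      by (auto simp: T_def y_def fun_scale_def fun_eq_iff algebra_simps)
  qed auto
qed

text \<open>A line through \<open>r\<close> meeting the support in exactly one point gives a nonzero coordinate of the
  projected word.\<close>

lemma project_word:
  fixes f :: "(nat \<Rightarrow> 'q::{field,finite}) \<Rightarrow> 'f::field"
  assumes f: "f \<in> vector_words (Suc k) (Suc m)"
    and r: "r \<in> coord_space (Suc m)" "r \<noteq> 0" "f r = 0"
    and u: "f u \<noteq> 0" "\<And>b. b \<noteq> 0 \<Longrightarrow> f (u + fun_scale b r) = 0"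
  shows "\<exists>g :: (nat \<Rightarrow> 'q) \<Rightarrow> 'f. g \<in> vector_words k m \<and> g \<noteq> 0 \<and>
    card {v. g v \<noteq> 0} \<le> card {v. f v \<noteq> 0}"
proof -
  let ?C = "coord_space (Suc m) :: (nat \<Rightarrow> 'q) set"
  obtain T where T: "\<And>x y. T (x + y) = T x + T y" "\<And>a x. T (fun_scale a x) = fun_scale a (T x)"
    "T ` ?C = coord_space m" "\<And>x. x \<in> ?C \<Longrightarrow> T x = 0 \<longleftrightarrow> x \<in> fun_space.span {r}"
    using projection_exists[OF r(1,2)] by metis
  have f0: "f 0 = 0" and fout: "\<And>v. v \<notin> ?C \<Longrightarrow> f v = 0"
    and fhom: "\<And>a v. a \<noteq> 0 \<Longrightarrow> f (fun_scale a v) = f v"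
    and fsum: "\<And>U. fun_space.subspace U \<Longrightarrow> U \<subseteq> ?C \<Longrightarrow> card U = CARD('q) ^ (Suc k + 1)
      \<Longrightarrow> sum f U = 0"
    using f unfolding vector_words_def by blast+
  note sub = subspace_coord_space[of "Suc m", where 'a = 'q]
  have finC: "finite ?C" by (rule finite_coord_space)
  have fr: "f x = 0" if "x \<in> fun_space.span {r}" for x
    using that r fhom f0 by (auto simp: mem_span_singleton) (metis fun_space.scale_zero_left)
  have uC: "u \<in> ?C" using u fout by blast
  \<comment> \<open>Fibre sums of \<open>f\<close> under the projection. The value \<open>0\<close>
    at \<open>w = 0\<close> agrees with the fibre sum there, as \<open>f\<close> vanishes on the
    span of \<open>r\<close>.\<close>
  define g where "g w = (if w = 0 then 0 else \<Sum>v | v \<in> ?C \<and> T v = w. f v)" for w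
  have supp: "{w. g w \<noteq> 0} \<subseteq> T ` {v. f v \<noteq> 0}"
  proof
    fix w assume "w \<in> {w. g w \<noteq> 0}"
    then have "(\<Sum>v | v \<in> ?C \<and> T v = w. f v) \<noteq> 0" by (auto simp: g_def split: if_splits)
    then obtain v where "v \<in> {v. v \<in> ?C \<and> T v = w}" "f v \<noteq> 0"
      by (rule sum.not_neutral_contains_not_neutral)
    then show "w \<in> T ` {v. f v \<noteq> 0}" by auto
  qed
  have finsupp: "finite {v. f v \<noteq> 0}"
    using fout finC by (metis (mono_tags, lifting) finite_subset mem_Collect_eq subsetI)
  have card: "card {w. g w \<noteq> 0} \<le> card {v. f v \<noteq> 0}"
    by (rule surj_card_le[OF finsupp supp])
  have "g \<noteq> 0"
  proof -
    have Tu: "T u \<noteq> 0" using T(4)[OF uC] fr u by blast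
    \<comment> \<open>The fibre through \<open>u\<close> consists of the vectors
      \<open>u + b r\<close>, and \<open>f\<close> vanishes at all of them but
      \<open>u\<close>.\<close>
    have "(\<Sum>v | v \<in> ?C \<and> T v = T u. f v) = (\<Sum>v\<in>{u}. f v)"
    proof (rule sum.mono_neutral_right)
      show "\<forall>v\<in>{v. v \<in> ?C \<and> T v = T u} - {u}. f v = 0"
      proof
        fix v assume v: "v \<in> {v. v \<in> ?C \<and> T v = T u} - {u}"
        have "T (v - u) = 0" using v T(1)[of "v - u" u] by simp
        moreover have "v - u \<in> ?C" using v uC sub fun_space.subspace_diff by blast
        ultimately obtain b where b: "v - u = fun_scale b r" using T(4) mem_span_singleton by blast
        then have "b \<noteq> 0" "v = u + fun_scale b r" using v by (auto simp: algebra_simps)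
        then show "f v = 0" using u by simp
      qed
    qed (use finC uC in auto)
    then have "g (T u) \<noteq> 0" using Tu u by (simp add: g_def)
    then show ?thesis by auto
  qed
  moreover have "g \<in> vector_words k m"
    unfolding vector_words_def
  proof (intro CollectI conjI allI impI)
    show "g 0 = 0" by (simp add: g_def)
    show "g w = 0" if w: "w \<notin> coord_space m" for w
    proof -
      have "{v. v \<in> ?C \<and> T v = w} = {}" using w T(3) by blast
      then show ?thesis unfolding g_def by (metis sum.empty)
    qed
    show "g (fun_scale a w) = g w" if a: "a \<noteq> 0" for a w
    proof -
      have "(\<Sum>v | v \<in> ?C \<and> T v = w. f v) = (\<Sum>v | v \<in> ?C \<and> T v = fun_scale a w. f v)"
        by (rule sum.reindex_bij_witness[where i = "fun_scale (inverse a)" and j = "fun_scale a"])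
          (use a sub fhom in \<open>auto simp: T(2) fun_space.subspace_scale\<close>)
      then show ?thesis using a by (simp add: g_def)
    qed
    fix U :: "(nat \<Rightarrow> 'q) set"
    assume U: "fun_space.subspace U" "U \<subseteq> coord_space m" "card U = CARD('q) ^ (k + 1)"
    \<comment> \<open>The preimage of \<open>U\<close> contains the kernel, which has
      \<open>q\<close> vectors, so its linear dimension is \<open>k + 2\<close> and \<open>f\<close>
      sums to zero on it. Grouping that sum by fibres gives the sum of \<open>g\<close> over
      \<open>U\<close>.\<close>
    let ?W = "{v \<in> ?C. T v \<in> U}"
    have T0: "T 0 = 0" using T(1)[of 0 0] by simp
    have W: "fun_space.subspace ?W"
      using sub U(1) T0 T(1,2) by (auto simp: fun_space.subspace_def)
    have "U \<subseteq> T ` ?C" using T(3) U(2) by simp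
    then have TW: "T ` ?W = U" by auto
    have fin: "finite ?W" using finC by simp
    have U0: "0 \<in> U" using U(1) by (rule fun_space.subspace_0)
    have rC: "fun_space.span {r} \<subseteq> ?C" using span_singleton_subset[OF sub r(1)] .
    have "{v \<in> ?W. T v = 0} = fun_space.span {r}"
    proof (intro equalityI subsetI)
      fix x assume x: "x \<in> fun_space.span {r}"
      then have "x \<in> ?C" using rC by blast
      then show "x \<in> {v \<in> ?W. T v = 0}" using T(4)[of x] x U0 by simp
    qed (use T(4) in auto)
    moreover have "card ?W = card (T ` ?W) * card {v \<in> ?W. T v = 0}"
      by (rule card_eq_image_times_kernel[OF fin])
        (rule fun_space.subspace_add[OF W] fun_space.subspace_diff[OF W] T(1); assumption)+
    ultimately have "card ?W = CARD('q) ^ (Suc k + 1)"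
      using card_span_singleton[OF r(2)] U(3) TW by simp
    then have "sum f ?W = 0" using W by (intro fsum) auto
    moreover have "sum g U = sum f ?W"
    proof -
      have "g w = (\<Sum>v | v \<in> ?W \<and> T v = w. f v)" if w: "w \<in> U" for w
      proof (cases "w = 0")
        case True
        have "(\<Sum>v | v \<in> ?W \<and> T v = w. f v) = 0"
          using T(4) fr True by (intro sum.neutral) auto
        then show ?thesis using True by (simp add: g_def)
      next
        case False
        have "{v. v \<in> ?W \<and> T v = w} = {v. v \<in> ?C \<and> T v = w}" using w by auto
        then show ?thesis using False by (simp add: g_def)
      qed
      then have "sum g U = (\<Sum>w\<in>T ` ?W. \<Sum>v | v \<in> ?W \<and> T v = w. f v)"
        using TW by simp
      also have "\<dots> = sum f ?W" using sum.image_gen[OF fin, of f T] by simp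
      finally show ?thesis .
    qed
    ultimately show "sum g U = 0" by simp
  qed
  ultimately show ?thesis using card by blast
qed

text \<open>If every point off \<open>u\<close> were joined to \<open>u\<close> by a line containing a second support point,
  projecting from \<open>u\<close> would map the support onto all of \<open>F\<^sup>m\<^sup>+\<^sup>1\<close>.\<close>

lemma ex_projected_word:
  fixes f :: "(nat \<Rightarrow> 'q::{field,finite}) \<Rightarrow> 'f::field"
  assumes f: "f \<in> vector_words (Suc k) (Suc m)" "f \<noteq> 0"
    and small: "card {v. f v \<noteq> 0} < CARD('q) ^ (m + 1)"
  shows "\<exists>g :: (nat \<Rightarrow> 'q) \<Rightarrow> 'f. g \<in> vector_words k m \<and> g \<noteq> 0 \<and>
    card {v. g v \<noteq> 0} \<le> card {v. f v \<noteq> 0}"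
proof -
  let ?C = "coord_space (Suc m) :: (nat \<Rightarrow> 'q) set"
  obtain u where u: "f u \<noteq> 0" using f(2) by (auto simp: fun_eq_iff)
  have f0: "f 0 = 0" and fout: "\<And>v. v \<notin> ?C \<Longrightarrow> f v = 0"
    and fhom: "\<And>a v. a \<noteq> 0 \<Longrightarrow> f (fun_scale a v) = f v"
    using f(1) unfolding vector_words_def by blast+
  have uC: "u \<in> ?C" "u \<noteq> 0" using u fout f0 by auto
  obtain T where T: "\<And>x y. T (x + y) = T x + T y" "\<And>a x. T (fun_scale a x) = fun_scale a (T x)"
    "T ` ?C = coord_space m" "\<And>x. x \<in> ?C \<Longrightarrow> T x = 0 \<longleftrightarrow> x \<in> fun_space.span {u}"
    using projection_exists[OF uC] by metis
  have finsupp: "finite {v. f v \<noteq> 0}"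
    using fout finite_coord_space by (metis (mono_tags, lifting) finite_subset mem_Collect_eq subsetI)
  \<comment> \<open>The image of the support is no larger than the support, hence smaller than
    \<open>q ^ (m + 1)\<close>.\<close>
  have "\<not> coord_space m \<subseteq> T ` {v. f v \<noteq> 0}"
    using surj_card_le[OF finsupp, of "coord_space m" T] small card_coord_space[of m, where 'q = 'q]
    by auto
  then have "\<not> T ` ?C \<subseteq> T ` {v. f v \<noteq> 0}" using T(3) by simp
  then obtain w where w: "w \<in> ?C" "T w \<notin> T ` {v. f v \<noteq> 0}" by (auto simp only: image_subset_iff)
  have Tu: "T u = 0" using T(4)[OF uC(1)] fun_space.span_base by blast
  \<comment> \<open>All vectors \<open>w + b u\<close> have the image \<open>T w\<close>, which lies
    outside the image of the support.\<close>
  have fw: "f (w + fun_scale b u) = 0" for b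
    using w(2) T(1)[of w "fun_scale b u"] T(2)[of b u] Tu by (auto simp: image_iff)
  show ?thesis
  \<comment> \<open>The centre of projection is \<open>w\<close>. On the line joining it to
    \<open>u\<close>, only the point of \<open>u\<close> lies in the support.\<close>
  proof (rule project_word[OF f(1) w(1) _ _ u])
    \<comment> \<open>The image of the support contains \<open>T u = 0\<close>, so it misses
      \<open>T w\<close> only if \<open>w\<close> is nonzero.\<close>
    show "w \<noteq> 0" using w(2) u T(2)[of 0 u] Tu by (force simp: image_iff)
    show "f w = 0" using fw[of 0] by simp
    fix b :: 'q assume b: "b \<noteq> 0"
    have "u + fun_scale b w = fun_scale b (w + fun_scale (inverse b) u)"
      using b by (auto simp: fun_scale_def fun_eq_iff algebra_simps)
    then show "f (u + fun_scale b w) = 0" using fhom[OF b] fw by simp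
  qed
qed

section \<open>Embedding and existence of words\<close>

text \<open>Either \<open>U\<close> meets the hyperplane \<open>coord_space m\<close> in linear
  dimension \<open>k + 1\<close>, and \<open>f\<close> vanishes on the rest of \<open>U\<close>; or
  \<open>U\<close> lies inside it, and the vanishing of the sums over the hyperplanes of
  \<open>U\<close> passes to \<open>U\<close>.\<close>

lemma vector_words_embed:
  fixes f :: "(nat \<Rightarrow> 'q::{field,finite}) \<Rightarrow> 'f::field"
  assumes char: "of_nat CARD('q) = (0::'f)" and f: "f \<in> vector_words k m" and k: "k \<ge> 1"
  shows "f \<in> vector_words (Suc k) (Suc m)"
proof -
  have fout: "\<And>v. v \<notin> coord_space m \<Longrightarrow> f v = 0"
    and fsum: "\<And>U. fun_space.subspace U \<Longrightarrow> U \<subseteq> coord_space m \<Longrightarrow> card U = CARD('q) ^ Suc k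
      \<Longrightarrow> sum f U = 0"
    using f unfolding vector_words_def by auto
  have "sum f U = 0" if U: "fun_space.subspace U" "U \<subseteq> coord_space (Suc m)"
    "card U = CARD('q) ^ Suc (Suc k)" for U
  proof -
    have fin: "finite U" using U(2) finite_coord_space finite_subset by blast
    have in_iff: "v \<in> coord_space m \<longleftrightarrow> v (Suc m) = 0" if "v \<in> U" for v
    proof -
      have "\<forall>i>Suc m. v i = 0" using that U(2) by (auto simp: coord_space_def)
      then show ?thesis unfolding coord_space_def by (auto dest: Suc_lessI)
    qed
    show ?thesis
    proof (cases "\<exists>w\<in>U. w (Suc m) \<noteq> 0")
      case True
      then obtain w where w: "w \<in> U" "w (Suc m) \<noteq> 0" by blast
      let ?H = "{v \<in> U. v (Suc m) = 0}"
      have H: "fun_space.subspace ?H" "card ?H = CARD('q) ^ Suc k"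
        by (rule card_hyperplane[OF U(1) fin U(3), where \<phi> = "\<lambda>v. v (Suc m)" and w = w];
            use w in \<open>simp add: fun_scale_def\<close>)+
      have "sum f U = sum f ?H"
        using fin in_iff fout by (intro sum.mono_neutral_right) auto
      also have "\<dots> = 0" using in_iff H by (intro fsum) auto
      finally show ?thesis .
    next
      case False
      then have "U \<subseteq> coord_space m" using in_iff by blast
      then show ?thesis
        using k fsum by (intro sum_subspace_eq_0_of_hyperplanes[OF char U(1) fin U(3)]) auto
    qed
  qed
  then show ?thesis
    using f coord_space_mono[of m "Suc m"] unfolding vector_words_def by auto
qed

text \<open>The difference of the indicators of the hyperplanes \<open>x_0 = 0\<close> and
  \<open>x_1 = 0\<close> works: a subspace of linear dimension \<open>k + 1\<close> meets each in
  \<open>q ^ k\<close> or \<open>q ^ (k + 1)\<close> vectors, both zero in \<open>'f\<close>. Such a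
  word keeps the minimum weight from being the junk value of a zero code.\<close>

lemma ex_vector_word:
  assumes char: "of_nat CARD('q::{field,finite}) = (0::'f::field)" and "k \<ge> 1" "m \<ge> 1"
  shows "\<exists>f \<in> vector_words k m. f \<noteq> (0 :: (nat \<Rightarrow> 'q) \<Rightarrow> 'f)"
proof -
  define f :: "(nat \<Rightarrow> 'q) \<Rightarrow> 'f" where
    "f v = (if v \<in> coord_space m then of_bool (v 0 = 0) - of_bool (v 1 = 0) else 0)" for v
  have "f 0 = 0" by (simp add: f_def)
  moreover have "f (fun_scale a v) = f v" if "a \<noteq> 0" for a v
  proof -
    have "fun_scale a v \<in> coord_space m \<longleftrightarrow> v \<in> coord_space m"
      using that by (simp add: fun_scale_def coord_space_def)
    then show ?thesis using that by (simp add: f_def fun_scale_def)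
  qed
  moreover have "sum f U = 0" if U: "fun_space.subspace U" "U \<subseteq> coord_space m"
    "card U = CARD('q) ^ Suc k" for U
  proof -
    have fin: "finite U" using U(2) finite_coord_space finite_subset by blast
    have "of_nat (card {v \<in> U. v i = 0}) = (0::'f)" for i
    proof (cases "\<exists>w\<in>U. w i \<noteq> 0")
      case True
      then obtain w where w: "w \<in> U" "w i \<noteq> 0" by blast
      have "card {v \<in> U. v i = 0} = CARD('q) ^ k"
        by (rule card_hyperplane(2)[OF U(1) fin U(3), where \<phi> = "\<lambda>v. v i" and w = w])
          (use w in \<open>auto simp: fun_scale_def\<close>)
      then show ?thesis using char \<open>k \<ge> 1\<close> by simp
    next
      case False
      then have "{v \<in> U. v i = 0} = U" by blast
      then show ?thesis using U(3) char by simp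
    qed
    moreover have "(\<Sum>v\<in>U. of_bool (v i = 0)) = (of_nat (card {v \<in> U. v i = 0}) :: 'f)" for i
      using fin by (simp add: sum.inter_filter[symmetric] of_bool_def)
    moreover have "sum f U = (\<Sum>v\<in>U. of_bool (v 0 = 0) - of_bool (v 1 = 0))"
      using U(2) by (intro sum.cong) (auto simp: f_def)
    ultimately show ?thesis by (simp add: sum_subtractf)
  qed
  ultimately have "f \<in> vector_words k m" by (auto simp: vector_words_def f_def)
  \<comment> \<open>This unit vector lies on the first hyperplane but not on the second.\<close>
  moreover have "f (\<lambda>i. of_bool (i = 1)) \<noteq> 0"
    using \<open>m \<ge> 1\<close> by (auto simp: f_def coord_space_def)
  then have "f \<noteq> 0" by auto
  ultimately show ?thesis by blast
qed

section \<open>Minimum weights\<close>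

lemma min_weight_le: "c \<in> C \<Longrightarrow> c \<noteq> 0 \<Longrightarrow> min_weight C \<le> weight c"
  unfolding min_weight_def by (intro wellorder_Inf_le1) auto

lemma min_weight_attained:
  assumes "c \<in> C" "c \<noteq> 0"
  obtains d where "d \<in> C" "d \<noteq> 0" "weight d = min_weight C"
proof -
  have "min_weight C \<in> weight ` (C - {0})"
    unfolding min_weight_def using assms by (intro Inf_nat_def1) auto
  then obtain d where "d \<in> C - {0}" "min_weight C = weight d" by (rule imageE)
  then show thesis using that[of d] by simp
qed

lemma lift_word_0: "lift_word 0 = 0"
  by (rule ext) (simp add: lift_word_def)

text \<open>Extension by zero gives \<open>\<le>\<close>. This bound makes a word of minimum weight
  in the larger space sparse enough to be projected, which gives \<open>\<ge>\<close>.\<close>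

lemma min_weight_dual_pg_code_Suc:
  assumes char: "of_nat CARD('q::{field,finite}) = (0::'f::field)" and k: "k \<ge> 1" and m: "m \<ge> 1"
  shows "min_weight (dual_code (pg_points (Suc m))
            (pg_code (Suc k) (Suc m) :: ((nat \<Rightarrow> 'q) set \<Rightarrow> 'f) set)) =
         min_weight (dual_code (pg_points m) (pg_code k m :: ((nat \<Rightarrow> 'q) set \<Rightarrow> 'f) set))"
    (is "min_weight ?D' = min_weight ?D")
proof -
  have pts: "pg_points m \<subseteq> (pg_points (Suc m) :: (nat \<Rightarrow> 'q) set set)"
    using coord_space_mono[of m "Suc m"] by (auto simp: pg_points_eq)
  have sub: "?D \<subseteq> ?D'"
    unfolding subset_iff dual_pg_code_iff[OF char] using vector_words_embed[OF char _ k] pts by blast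
  obtain f0 :: "(nat \<Rightarrow> 'q) \<Rightarrow> 'f" where f0: "f0 \<in> vector_words k m" "f0 \<noteq> 0"
    using ex_vector_word[OF char k m] by blast
  obtain c0 where c0: "c0 \<in> ?D" "lift_word c0 = f0" using lift_word_surj[OF char f0(1)] .
  have "c0 \<noteq> 0" using c0 f0 lift_word_0 by metis
  obtain d where d: "d \<in> ?D" "d \<noteq> 0" "weight d = min_weight ?D"
    using min_weight_attained[OF c0(1) \<open>c0 \<noteq> 0\<close>] .
  have le: "min_weight ?D' \<le> min_weight ?D"
    using min_weight_le[of d ?D'] d sub by auto
  obtain c where c: "c \<in> ?D'" "c \<noteq> 0" "weight c = min_weight ?D'"
    using min_weight_attained[of d ?D'] d sub by blast
  let ?f = "lift_word c"
  have cout: "\<forall>P. P \<notin> pg_points (Suc m) \<longrightarrow> c P = 0"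
    and f: "?f \<in> vector_words (Suc k) (Suc m)"
    using c(1) by (auto simp: dual_pg_code_iff[OF char])
  have dout: "\<forall>P. P \<notin> pg_points m \<longrightarrow> d P = 0" and fd: "lift_word d \<in> vector_words k m"
    using d(1) by (auto simp: dual_pg_code_iff[OF char])
  have "?f \<noteq> 0"
  proof
    assume "?f = 0"
    then have "(CARD('q) - 1) * weight c = 0"
      using card_support_lift_word[OF cout] by simp
    then have "weight c = 0" using card_field_ge_2[where 'q = 'q] by simp
    moreover have "finite {P. c P \<noteq> 0}"
      using cout finite_pg_points by (metis (mono_tags, lifting) finite_subset mem_Collect_eq subsetI)
    ultimately show False using c(2) by (auto simp: weight_def fun_eq_iff)
  qed
  \<comment> \<open>The minimum-weight word \<open>d\<close> of the smaller code is supported on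
    nonzero vectors of \<open>coord_space m\<close>, and \<open>c\<close> weighs no more than
    \<open>d\<close>.\<close>
  moreover have "card {v. ?f v \<noteq> 0} < CARD('q) ^ (m + 1)"
  proof -
    have "card {v. ?f v \<noteq> 0} \<le> card {v. lift_word d v \<noteq> 0}"
      using card_support_lift_word[OF cout] card_support_lift_word[OF dout] c(3) d(3) le by simp
    also have "\<dots> < card (coord_space m :: (nat \<Rightarrow> 'q) set)"
    proof (rule psubset_card_mono)
      show "{v. lift_word d v \<noteq> 0} \<subset> coord_space m"
        using fd fun_space.subspace_0[OF subspace_coord_space, of m]
        unfolding vector_words_def by blast
    qed (rule finite_coord_space)
    finally show ?thesis by (simp add: card_coord_space)
  qed
  ultimately obtain g :: "(nat \<Rightarrow> 'q) \<Rightarrow> 'f" where g: "g \<in> vector_words k m" "g \<noteq> 0"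
    "card {v. g v \<noteq> 0} \<le> card {v. ?f v \<noteq> 0}"
    using ex_projected_word[OF f] by blast
  obtain e where e: "e \<in> ?D" "lift_word e = g" using lift_word_surj[OF char g(1)] .
  have "e \<noteq> 0" using e g lift_word_0 by metis
  have eout: "\<forall>P. P \<notin> pg_points m \<longrightarrow> e P = 0"
    using e(1) by (auto simp: dual_pg_code_iff[OF char])
  have "(CARD('q) - 1) * weight e \<le> (CARD('q) - 1) * weight c"
    using g(3) card_support_lift_word[OF cout] card_support_lift_word[OF eout] e(2) by simp
  then have "weight e \<le> weight c" using card_field_ge_2[where 'q = 'q] by simp
  then have "min_weight ?D \<le> min_weight ?D'"
    using min_weight_le[OF e(1) \<open>e \<noteq> 0\<close>] c(3) by simp
  then show ?thesis using le by simp
qed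

text \<open>Adding \<open>1\<close> permutes the field, so the sum of all elements is unchanged when
  \<open>q\<close> times \<open>1\<close> is added to it.\<close>

lemma of_nat_card_field: "of_nat CARD('f::{field,finite}) = (0::'f)"
proof -
  have "(\<Sum>x::'f\<in>UNIV. x) = (\<Sum>x::'f\<in>UNIV. x + 1)"
    by (rule sum.reindex_bij_witness[where i = "\<lambda>x. x + 1" and j = "\<lambda>x. x - 1"]) auto
  then show ?thesis by (simp add: sum.distrib)
qed

theorem theorem4p2:
  fixes p h n k :: nat
  assumes "prime p"
    and "CARD('q::{field,finite}) = p ^ h"
    and "CARD('f::{field,finite}) = p"
    and "n \<ge> 2"
    and "0 < k" and "k \<le> n - 1"
  shows "min_weight (dual_code (pg_points n)
            (pg_code k n :: ((nat \<Rightarrow> 'q) set \<Rightarrow> 'f) set)) =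
         min_weight (dual_code (pg_points (n - k + 1))
            (pg_code 1 (n - k + 1) :: ((nat \<Rightarrow> 'q) set \<Rightarrow> 'f) set))"
proof -
  \<comment> \<open>For \<open>h = 0\<close> the field would have a single element.\<close>
  have "h \<noteq> 0" using assms(2) card_field_ge_2[where 'q = 'q] by (cases h) auto
  then have char: "of_nat CARD('q) = (0::'f)"
    using assms(2,3) of_nat_card_field[where 'f = 'f] by simp
  \<comment> \<open>Raising both parameters together fixes their difference, so the induction runs
    over \<open>j = k - 1\<close> with \<open>m = n - k + 1\<close> fixed.\<close>
  have "min_weight (dual_code (pg_points (m + j))
            (pg_code (Suc j) (m + j) :: ((nat \<Rightarrow> 'q) set \<Rightarrow> 'f) set)) =
         min_weight (dual_code (pg_points m) (pg_code 1 m :: ((nat \<Rightarrow> 'q) set \<Rightarrow> 'f) set))"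
    if "m \<ge> 1" for m j
  proof (induction j)
    case 0
    then show ?case by simp
  next
    case (Suc j)
    then show ?case
      using min_weight_dual_pg_code_Suc[OF char, of "Suc j" "m + j"] that by simp
  qed
  from this[of "n - k + 1" "k - 1"] show ?thesis
    using assms by simp
qed

end
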